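(* Let $B=(B_{ij})$ be an $m\times n$ matrix with entries in $\mathbb{R}\cup\{-\infty\}$ which has no column consisting only of elements $-\infty$. Let $E=\{(i,j)\in[m]\times[n]: B_{ij}\neq-\infty\}$, and define $f:(\mathbb{R}\cup\{-\infty\})^n\to(\mathbb{R}\cup\{-\infty\})^n$ by $$f_j(x)=\min_{i\in[m],\,(i,j)\in E}\Bigl(-B_{ij}+\max_{k\in[n],\,k\neq j}(B_{ik}+x_k)\Bigr),\qquad j\in[n].$$ The following assertions are equivalent: 1. the columns of the matrix $B$ are tropically linearly independent; 2. Player Max has no winning state in the mean payoff game with dynamic programming operator $f$, i.e., $\bar\chi(f)<0$; 3. there exist a vector $w\in\mathbb{R}^n$ and a scalar $\lambda<0$ such that $f(w)\leq\lambda+w$; 4. there is no vector $u\in(\mathbb{R}\cup\{-\infty\})^n$, not identically $-\infty$, such that $u\leq f(u)$.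
   Context: Write $[n]=\{1,\dots,n\}$. Inequalities between vectors are entrywise, $\lambda+w$ is the vector obtained by adding $\lambda$ to every entry of $w$, and a maximum over an empty set is $-\infty$. The columns of $B$ are tropically linearly dependent if there exists $y\in(\mathbb{R}\cup\{-\infty\})^n$, not identically $-\infty$, such that for every $i\in[m]$ the maximum in $\max_{j\in[n]}(B_{ij}+y_j)$ is attained at least twice or is equal to $-\infty$; otherwise they are tropically linearly independent. The quantity $\bar\chi(f):=\lim_{N\to\infty}\max_{j\in[n]}f^N_j(x)/N\in\mathbb{R}\cup\{-\infty\}$ (with $f^N$ the $N$-th iterate) exists and is independent of the choice of $x\in\mathbb{R}^n$. By definition Player Max has a winning state when $\bar\chi(f)\geq0$. The game: in a column node $j$, Player Min chooses a row node $i$ with $(i,j)\in E$, moves to $i$ and receives $B_{ij}$; then Player Max must move to a column node $k\neq j$ and receives $B_{ik}$. *)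

theory Defs
  imports "HOL-Analysis.Extended_Real_Limits"
begin

text \<open>
  \<open>\<real> \<union> {-\<infinity>}\<close> is rendered as the elements of \<^typ>\<open>ereal\<close> other than \<open>\<infinity>\<close>. The index sets \<open>[m]\<close>, \<open>[n]\<close>
  are finite types \<open>'m\<close>, \<open>'n\<close>, vectors are functions on them (ordered entrywise), and a matrix is a
  function \<open>B i j\<close>. All suprema below range over finite sets, so they are maxima; on the empty set
  they equal \<open>bot = -\<infinity>\<close>, as the usual convention demands.
\<close>

definition tropically_dependent :: "('m::finite \<Rightarrow> 'n::finite \<Rightarrow> ereal) \<Rightarrow> bool" where
  "tropically_dependent B \<longleftrightarrow>
    (\<exists>y :: 'n \<Rightarrow> ereal. (\<forall>j. y j \<noteq> \<infinity>) \<and> (\<exists>j. y j \<noteq> -\<infinity>) \<and>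
      (\<forall>i. let M = (SUP j. B i j + y j) in
         M = -\<infinity> \<or> (\<exists>j k. j \<noteq> k \<and> B i j + y j = M \<and> B i k + y k = M)))"

definition tropically_independent :: "('m::finite \<Rightarrow> 'n::finite \<Rightarrow> ereal) \<Rightarrow> bool" where
  "tropically_independent B \<longleftrightarrow> \<not> tropically_dependent B"

definition finite_entries :: "('m::finite \<Rightarrow> 'n::finite \<Rightarrow> ereal) \<Rightarrow> ('m \<times> 'n) set" where
  "finite_entries B = {(i, j). B i j \<noteq> -\<infinity>}"

text \<open>
  The infimum is a minimum over a nonempty set as soon as every column of \<open>B\<close> has a finite entry.
\<close>

definition dyn_op :: "('m::finite \<Rightarrow> 'n::finite \<Rightarrow> ereal) \<Rightarrow> ('n \<Rightarrow> ereal) \<Rightarrow> 'n \<Rightarrow> ereal" where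
  "dyn_op B x j =
    (INF i \<in> {i. (i, j) \<in> finite_entries B}. - B i j + (SUP k \<in> {k. k \<noteq> j}. B i k + x k))"

text \<open>
  \<open>\<chi>(f)\<close> is the common value of the limits of \<open>max\<^sub>j f\<^sup>N\<^sub>j(x) / N\<close> over all finite starting vectors \<open>x\<close>.
  That this is well defined for the operators considered here is the lemma
  \<open>upper_value_dyn_op\<close> below.
\<close>

definition upper_value :: "(('n::finite \<Rightarrow> ereal) \<Rightarrow> 'n \<Rightarrow> ereal) \<Rightarrow> ereal" where
  "upper_value f = (THE c. \<forall>x :: 'n \<Rightarrow> real.
     (\<lambda>N. (SUP j. (f ^^ N) (\<lambda>k. ereal (x k)) j) / ereal (real N)) \<longlonglongrightarrow> c)"

definition max_has_winning_state :: "(('n::finite \<Rightarrow> ereal) \<Rightarrow> 'n \<Rightarrow> ereal) \<Rightarrow> bool" where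
  "max_has_winning_state f \<longleftrightarrow> upper_value f \<ge> 0"


subsection \<open>Existence of the limit\<close>

lemma fekete_ereal:
  fixes t :: "nat \<Rightarrow> ereal"
  assumes sub: "\<And>M N. t (M + N) \<le> t M + t N" and fin: "\<And>N. t N \<noteq> \<infinity>"
  shows "(\<lambda>N. t N / ereal (real N)) \<longlonglongrightarrow> (INF N \<in> {1..}. t N / ereal (real N))"
    (is "_ \<longlonglongrightarrow> ?L")
proof (rule order_tendstoI)
  fix a assume "a < ?L"
  have "?L \<le> t N / ereal (real N)" if "N \<ge> 1" for N
    using that by (intro INF_lower) auto
  then show "\<forall>\<^sub>F N in sequentially. a < t N / ereal (real N)"
    using \<open>a < ?L\<close> by (intro eventually_sequentiallyI[of 1]) (auto intro: less_le_trans)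
next
  fix a assume "?L < a"
  then obtain K where K: "K \<ge> 1" "t K / ereal (real K) < a"
    by (auto simp: INF_less_iff)
  then obtain b where b: "t K / ereal (real K) < ereal b" "ereal b < a"
    using ereal_dense2 by blast
  have tK: "t K \<le> ereal (b * real K)"
    using b(1) K(1) fin[of K] by (cases "t K") (auto simp: field_simps)
  have "\<exists>d :: nat \<Rightarrow> real. \<forall>N. t N \<le> ereal (d N)"
    by (intro choice allI) (metis fin ereal_cases ereal_less_eq(2) order_refl)
  then obtain d :: "nat \<Rightarrow> real" where d: "\<And>N. t N \<le> ereal (d N)" by blast
  define D where "D = (\<Sum>r<K. \<bar>d r\<bar>)"
  have D: "t r \<le> ereal D" if "r < K" for r
  proof -
    have "d r \<le> \<bar>d r\<bar>" by simp
    also have "\<dots> \<le> D" unfolding D_def using that by (intro member_le_sum) auto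
    finally show ?thesis using d[of r] by (meson ereal_less_eq(3) order_trans)
  qed
  have mult: "t (q * K + r) \<le> ereal (real q * (b * real K) + D)" if "r < K" for q r
  proof (induction q)
    case 0 then show ?case using D[OF that] by simp
  next
    case (Suc q)
    have "t (Suc q * K + r) \<le> t K + t (q * K + r)" using sub[of K "q * K + r"] by (simp add: algebra_simps)
    also have "\<dots> \<le> ereal (b * real K) + ereal (real q * (b * real K) + D)"
      by (intro add_mono tK Suc.IH)
    finally show ?case by (simp add: algebra_simps)
  qed
  have bound: "t N / ereal (real N) \<le> ereal (b + (\<bar>b\<bar> * real K + D) / real N)" if "N \<ge> 1" for N
  proof -
    have "t N \<le> ereal (real (N div K) * (b * real K) + D)"
      using mult[of "N mod K" "N div K"] K(1) by simp
    also have "real (N div K) * (b * real K) + D \<le> b * real N + (\<bar>b\<bar> * real K + D)"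
    proof -
      have "real N = real (N div K) * real K + real (N mod K)"
        by (metis div_mult_mod_eq of_nat_add of_nat_mult)
      moreover have "- (b * real (N mod K)) \<le> \<bar>b\<bar> * real K"
      proof -
        have "- (b * real (N mod K)) \<le> \<bar>b\<bar> * real (N mod K)"
          by (metis abs_ge_minus_self abs_mult abs_of_nat)
        also have "\<dots> \<le> \<bar>b\<bar> * real K" using K(1) by (intro mult_left_mono) (auto simp: less_imp_le)
        finally show ?thesis .
      qed
      ultimately show ?thesis by (simp add: algebra_simps)
    qed
    finally have "t N \<le> ereal (b * real N + (\<bar>b\<bar> * real K + D))" by simp
    then show ?thesis using that by (cases "t N") (auto simp: field_simps)
  qed
  have "(\<lambda>N. b + (\<bar>b\<bar> * real K + D) / real N) \<longlonglongrightarrow> b + 0"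
    by (intro tendsto_add tendsto_const lim_const_over_n)
  then have "(\<lambda>N. ereal (b + (\<bar>b\<bar> * real K + D) / real N)) \<longlonglongrightarrow> ereal b" by simp
  then have "\<forall>\<^sub>F N in sequentially. ereal (b + (\<bar>b\<bar> * real K + D) / real N) < a"
    using b(2) by (rule order_tendstoD)
  then show "\<forall>\<^sub>F N in sequentially. t N / ereal (real N) < a"
    using eventually_ge_at_top[of 1] by eventually_elim (use bound in \<open>auto intro: le_less_trans\<close>)
qed

lemma dyn_op_mono: "x \<le> y \<Longrightarrow> dyn_op B x \<le> dyn_op B y"
  unfolding dyn_op_def le_fun_def
  by (intro allI INF_superset_mono add_left_mono SUP_subset_mono order_refl) auto

lemma dyn_op_iter_mono: "x \<le> y \<Longrightarrow> (dyn_op B ^^ N) x \<le> (dyn_op B ^^ N) y"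
  by (induction N) (auto intro: dyn_op_mono)

context
  fixes B :: "'m::finite \<Rightarrow> 'n::finite \<Rightarrow> ereal"
  assumes B_fin: "\<And>i j. B i j \<noteq> \<infinity>" and B_col: "\<And>j. \<exists>i. B i j \<noteq> -\<infinity>"
begin

lemma dyn_op_add_le: "dyn_op B (\<lambda>k. c + x k) j \<le> c + dyn_op B x j"
proof -
  let ?I = "{i. (i, j) \<in> finite_entries B}"
  let ?h = "\<lambda>x i. - B i j + (SUP k \<in> {k. k \<noteq> j}. B i k + x k)"
  have ne: "?I \<noteq> {}" using B_col[of j] by (auto simp: finite_entries_def)
  have "Inf (?h x ` ?I) \<in> ?h x ` ?I"
    using ne Min_in[of "?h x ` ?I"] Min_Inf[of "?h x ` ?I"] by simp
  then obtain i where i: "i \<in> ?I" "dyn_op B x j = ?h x i"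
    unfolding dyn_op_def by blast
  have "dyn_op B (\<lambda>k. c + x k) j \<le> ?h (\<lambda>k. c + x k) i"
    unfolding dyn_op_def using i(1) by (intro INF_lower) auto
  also have "\<dots> \<le> - B i j + (c + (SUP k \<in> {k. k \<noteq> j}. B i k + x k))"
    by (intro add_left_mono SUP_least) (auto simp: add.left_commute intro!: add_left_mono SUP_upper)
  also have "\<dots> = c + dyn_op B x j" by (simp add: i(2) add.left_commute)
  finally show ?thesis .
qed

lemma dyn_op_iter_add_le: "(dyn_op B ^^ N) (\<lambda>k. c + x k) j \<le> c + (dyn_op B ^^ N) x j"
proof (induction N arbitrary: j)
  case (Suc N)
  have "(dyn_op B ^^ Suc N) (\<lambda>k. c + x k) j \<le> dyn_op B (\<lambda>k. c + (dyn_op B ^^ N) x k) j"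
    using dyn_op_mono[of "(dyn_op B ^^ N) (\<lambda>k. c + x k)" "\<lambda>k. c + (dyn_op B ^^ N) x k" B] Suc.IH
    by (simp add: le_fun_def)
  also have "\<dots> \<le> c + (dyn_op B ^^ Suc N) x j" using dyn_op_add_le by simp
  finally show ?case .
qed simp

lemma dyn_op_not_PInf:
  assumes "\<And>k. x k \<noteq> \<infinity>" shows "dyn_op B x j \<noteq> \<infinity>"
proof -
  obtain i where i: "B i j \<noteq> -\<infinity>" using B_col by blast
  have "dyn_op B x j \<le> - B i j + (SUP k \<in> {k. k \<noteq> j}. B i k + x k)"
    unfolding dyn_op_def using i by (intro INF_lower) (auto simp: finite_entries_def)
  moreover have "(SUP k \<in> {k. k \<noteq> j}. B i k + x k) < \<infinity>"
  proof (cases "{k. k \<noteq> j} = {}")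
    case False
    then show ?thesis by (subst finite_Sup_less_iff) (auto simp: B_fin assms)
  qed (simp only: image_empty Sup_empty bot_ereal_def, simp)
  ultimately show ?thesis using i B_fin[of i j] by (auto simp: ereal_uminus_eq_reorder)
qed

lemma dyn_op_iter_not_PInf:
  assumes "\<And>k. x k \<noteq> \<infinity>" shows "(dyn_op B ^^ N) x j \<noteq> \<infinity>"
  by (induction N arbitrary: j) (auto simp: assms dyn_op_not_PInf)

lemma upper_value_dyn_op_limit:
  "\<exists>c. c \<noteq> \<infinity> \<and> (\<forall>x :: 'n \<Rightarrow> real.
     (\<lambda>N. (SUP j. (dyn_op B ^^ N) (\<lambda>k. ereal (x k)) j) / ereal (real N)) \<longlonglongrightarrow> c)"
proof -
  define T where "T x N = (SUP j. (dyn_op B ^^ N) (\<lambda>k. ereal (x k)) j)" for x :: "'n \<Rightarrow> real" and N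
  define t where "t = T (\<lambda>_. 0)"
  have T_up: "(dyn_op B ^^ N) (\<lambda>k. ereal (x k)) j \<le> T x N" for x N j
    unfolding T_def by (rule SUP_upper) simp
  have T_fin: "T x N \<noteq> \<infinity>" for x N
  proof -
    have "T x N \<in> range ((dyn_op B ^^ N) (\<lambda>k. ereal (x k)))"
      using Max_in[of "range ((dyn_op B ^^ N) (\<lambda>k. ereal (x k)))"]
        Max_Sup[of "range ((dyn_op B ^^ N) (\<lambda>k. ereal (x k)))"]
      unfolding T_def by simp
    then obtain j where "T x N = (dyn_op B ^^ N) (\<lambda>k. ereal (x k)) j" by auto
    then show ?thesis using dyn_op_iter_not_PInf[of "\<lambda>k. ereal (x k)"] by simp
  qed
  have sub: "t (M + N) \<le> t M + t N" for M N
  proof -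
    have "(dyn_op B ^^ (M + N)) (\<lambda>k. ereal 0) j \<le> t M + t N" for j
    proof -
      have "(dyn_op B ^^ (M + N)) (\<lambda>k. ereal 0) j = (dyn_op B ^^ N) ((dyn_op B ^^ M) (\<lambda>k. ereal 0)) j"
        by (simp add: add.commute[of M N] funpow_add)
      also have "\<dots> \<le> (dyn_op B ^^ N) (\<lambda>k. t M + ereal 0) j"
        using dyn_op_iter_mono[of "(dyn_op B ^^ M) (\<lambda>k. ereal 0)" "\<lambda>k. t M + ereal 0" N B] T_up[of M "\<lambda>_. 0"]
        by (simp add: le_fun_def t_def)
      also have "\<dots> \<le> t M + (dyn_op B ^^ N) (\<lambda>k. ereal 0) j" by (rule dyn_op_iter_add_le)
      also have "\<dots> \<le> t M + t N" using T_up[of N "\<lambda>_. 0"] by (intro add_left_mono) (simp add: t_def)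
      finally show ?thesis .
    qed
    then show ?thesis unfolding t_def T_def by (intro SUP_least) auto
  qed
  define L where "L = (INF N \<in> {1..}. t N / ereal (real N))"
  have lim0: "(\<lambda>N. t N / ereal (real N)) \<longlonglongrightarrow> L"
    unfolding L_def using sub T_fin t_def by (intro fekete_ereal) auto
  have "L \<le> t 1 / ereal (real 1)" unfolding L_def by (intro INF_lower) auto
  also have "\<dots> < \<infinity>" using T_fin[of "\<lambda>_. 0" 1] by (simp add: t_def flip: one_ereal_def)
  finally have L: "L \<noteq> \<infinity>" by simp
  have comp: "T x N \<le> ereal (\<Sum>k\<in>UNIV. \<bar>x k - z k\<bar>) + T z N" for x z N
    unfolding T_def[of x]
  proof (rule SUP_least)
    fix j
    let ?C = "\<Sum>k\<in>UNIV. \<bar>x k - z k\<bar>"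
    have "x k \<le> ?C + z k" for k
      using member_le_sum[of k UNIV "\<lambda>k. \<bar>x k - z k\<bar>"] by auto
    then have "(dyn_op B ^^ N) (\<lambda>k. ereal (x k)) j \<le> (dyn_op B ^^ N) (\<lambda>k. ereal ?C + ereal (z k)) j"
      using dyn_op_iter_mono[of "\<lambda>k. ereal (x k)" "\<lambda>k. ereal ?C + ereal (z k)" N B]
      by (simp add: le_fun_def)
    also have "\<dots> \<le> ereal ?C + (dyn_op B ^^ N) (\<lambda>k. ereal (z k)) j" by (rule dyn_op_iter_add_le)
    also have "\<dots> \<le> ereal ?C + T z N" by (intro add_left_mono T_up)
    finally show "(dyn_op B ^^ N) (\<lambda>k. ereal (x k)) j \<le> ereal ?C + T z N" .
  qed
  have "(\<lambda>N. T x N / ereal (real N)) \<longlonglongrightarrow> L" for x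
  proof -
    define C where "C = (\<Sum>k\<in>UNIV. \<bar>x k\<bar>)"
    have shift: "(\<lambda>N. ereal (s / real N) + t N / ereal (real N)) \<longlonglongrightarrow> L" for s
    proof -
      have "(\<lambda>N. ereal (s / real N)) \<longlonglongrightarrow> ereal 0"
        by (intro tendsto_ereal lim_const_over_n)
      from tendsto_add_ereal_general2[OF _ this lim0] show ?thesis by simp
    qed
    have quot: "u / ereal (real N) \<le> ereal (C / real N) + v / ereal (real N)"
      if "N \<ge> 1" "u \<le> ereal C + v" "u \<noteq> \<infinity>" "v \<noteq> \<infinity>" for u v N
      using that by (cases u; cases v) (auto simp: divide_right_mono simp flip: add_divide_distrib)
    have up: "T x N / ereal (real N) \<le> ereal (C / real N) + t N / ereal (real N)" if "N \<ge> 1" for N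
      using comp[of x N "\<lambda>_. 0"] that T_fin unfolding t_def
      by (intro quot) (auto simp: C_def)
    have lo: "ereal (- C / real N) + t N / ereal (real N) \<le> T x N / ereal (real N)" if "N \<ge> 1" for N
    proof -
      have "t N / ereal (real N) \<le> ereal (C / real N) + T x N / ereal (real N)"
        using comp[of "\<lambda>_. 0" N x] that T_fin unfolding t_def
        by (intro quot) (auto simp: C_def)
      then show ?thesis
        by (cases "t N / ereal (real N)"; cases "T x N / ereal (real N)") auto
    qed
    show ?thesis
      by (rule tendsto_sandwich[OF _ _ shift[of "-C"] shift[of C]])
        (auto intro!: eventually_sequentiallyI[of 1] up lo[simplified])
  qed
  with L show ?thesis unfolding T_def by blast
qed

lemma upper_value_dyn_op:
  "(\<lambda>N. (SUP j. (dyn_op B ^^ N) (\<lambda>k. ereal (x k)) j) / ereal (real N)) \<longlonglongrightarrow> upper_value (dyn_op B)"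
  "upper_value (dyn_op B) \<noteq> \<infinity>"
proof -
  obtain c where c: "c \<noteq> \<infinity>" "\<And>x :: 'n \<Rightarrow> real.
      (\<lambda>N. (SUP j. (dyn_op B ^^ N) (\<lambda>k. ereal (x k)) j) / ereal (real N)) \<longlonglongrightarrow> c"
    using upper_value_dyn_op_limit by blast
  have "upper_value (dyn_op B) = c"
    unfolding upper_value_def using c(2) by (intro the_equality) (auto intro: LIMSEQ_unique)
  with c show "(\<lambda>N. (SUP j. (dyn_op B ^^ N) (\<lambda>k. ereal (x k)) j) / ereal (real N)) \<longlonglongrightarrow> upper_value (dyn_op B)"
    "upper_value (dyn_op B) \<noteq> \<infinity>" by auto
qed

end

end

theory Submission
  imports Defs "HOL-Analysis.Analysis"
begin

text \<open>
  Multiplying out, \<open>u \<le> f(u)\<close> says that in each row \<open>i\<close> every term \<open>B\<^sub>i\<^sub>j + u\<^sub>j\<close> is dominated by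
  another term of the same row, that is, that the row maximum is \<open>-\<infinity>\<close> or attained twice. So a
  subharmonic vector \<open>u\<close> is the same thing as a tropical linear dependence of the columns.

  The rest rests on the two kinds of certificate for the growth rate of the monotone and
  additively homogeneous map \<open>f\<close>. A vector \<open>w\<close> with \<open>f(w) \<le> c + w\<close> and \<open>c < 0\<close> forces every orbit to
  fall at least as fast as \<open>c N\<close>, so \<open>\<chi>(f) < 0\<close>; a vector \<open>u \<le> f(u)\<close> with some finite entry keeps
  this entry bounded below along the orbit of any finite vector above \<open>u\<close>, so \<open>\<chi>(f) \<ge> 0\<close>.
  Hence the two certificates exclude each other, and everything follows once it is known that one of them always exists.

  This last fact is a nonlinear Perron--Frobenius argument. Exponentiation turns \<open>f\<close> into a
  continuous self-map \<open>F\<close> of the closed orthant. For \<open>\<epsilon> > 0\<close> the map \<open>F + \<epsilon>\<close>, normalised to the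
  standard simplex, has a fixed point by Brouwer's theorem, that is, a positive \<open>x\<close> with
  \<open>F(x) + \<epsilon> = \<rho> x\<close>. If \<open>\<rho> < 1\<close> for some \<open>\<epsilon>\<close>, then \<open>w = ln x\<close> and \<open>c = ln \<rho>\<close> certify \<open>\<chi>(f) < 0\<close>.
  Otherwise \<open>x \<le> F(x) + \<epsilon>\<close> for every \<open>\<epsilon>\<close>, and a limit point in the compact simplex satisfies
  \<open>x \<le> F(x)\<close>; its logarithm, with \<open>-\<infinity>\<close> for the entries that vanish in the limit, is a
  subharmonic vector. The alternative itself is \<open>super_or_sub_eigenvector\<close>, and
  \<open>supereigenvector_if_no_subharmonic\<close> carries it over to \<open>f\<close>.
\<close>

section \<open>Sub- and supereigenvectors of continuous maps of the orthant\<close>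

definition std_simplex :: "(real ^ 'n::finite) set" where
  "std_simplex = {x. (\<forall>j. 0 \<le> x $ j) \<and> (\<Sum>j\<in>UNIV. x $ j) = 1}"

lemma compact_std_simplex: "compact (std_simplex :: (real ^ 'n::finite) set)"
proof -
  have "closed ({x. \<forall>j. 0 \<le> x $ j} \<inter> {x :: real ^ 'n. (\<Sum>j\<in>UNIV. x $ j) = 1})"
    by (intro closed_Int closed_Collect_all closed_Collect_le closed_Collect_eq continuous_intros)
  moreover have "norm x \<le> 1" if "x \<in> std_simplex" for x :: "real ^ 'n"
    using norm_le_l1_cart[of x] that by (simp add: std_simplex_def)
  ultimately show ?thesis
    by (auto simp: compact_eq_bounded_closed bounded_iff std_simplex_def Collect_conj_eq)
qed

lemma convex_std_simplex: "convex (std_simplex :: (real ^ 'n::finite) set)"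
  unfolding convex_def std_simplex_def
  by (auto simp: sum.distrib simp flip: sum_distrib_left)

lemma std_simplex_nonempty: "(std_simplex :: (real ^ 'n::finite) set) \<noteq> {}"
proof -
  have "(\<chi> j. 1 / real CARD('n)) \<in> (std_simplex :: (real ^ 'n) set)"
    by (simp add: std_simplex_def)
  then show ?thesis by blast
qed

text \<open>
  Brouwer's theorem applies to \<open>F + \<epsilon>\<close> after division by the sum of the entries; the shift \<open>\<epsilon>\<close>
  keeps this sum, and with it all entries of the fixed point, away from zero.
\<close>
lemma perturbed_positive_eigenvector:
  fixes F :: "real ^ 'n::finite \<Rightarrow> real ^ 'n"
  assumes cont: "continuous_on std_simplex F"
    and nonneg: "\<And>x j. x \<in> std_simplex \<Longrightarrow> 0 \<le> F x $ j"
    and e: "e > 0"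
  obtains x r where "x \<in> std_simplex" "r > 0" "\<And>j. x $ j > 0" "\<And>j. F x $ j + e = r * x $ j"
proof -
  define s where "s x = (\<Sum>j\<in>UNIV. F x $ j + e)" for x
  define H where "H x = (\<chi> j. (F x $ j + e) / s x)" for x
  have s: "s x > 0" if "x \<in> std_simplex" for x
    unfolding s_def using nonneg[OF that] e by (intro sum_pos) (auto intro: add_nonneg_pos)
  have "\<forall>x \<in> std_simplex. s x \<noteq> 0" using s by force
  then have "continuous_on std_simplex H"
    unfolding H_def s_def by (intro continuous_intros cont) auto
  moreover have "H \<in> std_simplex \<rightarrow> std_simplex"
  proof
    fix x :: "real ^ 'n" assume x: "x \<in> std_simplex"
    have "(\<Sum>j\<in>UNIV. H x $ j) = s x / s x"
      by (simp add: H_def s_def flip: sum_divide_distrib)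
    then show "H x \<in> std_simplex"
      using s[OF x] nonneg[OF x] e
      by (auto simp: std_simplex_def H_def intro!: divide_nonneg_pos add_nonneg_nonneg)
  qed
  ultimately obtain x where x: "x \<in> std_simplex" "H x = x"
    using brouwer compact_std_simplex convex_std_simplex std_simplex_nonempty by blast
  have Hx: "x $ j = (F x $ j + e) / s x" for j
    using x(2) unfolding H_def by (metis vec_lambda_beta)
  show thesis
  proof (rule that[OF x(1) s[OF x(1)]])
    show "x $ j > 0" for j
      using s[OF x(1)] nonneg[OF x(1), of j] e by (subst Hx) (auto intro!: divide_pos_pos)
    show "F x $ j + e = s x * x $ j" for j
      using s[OF x(1)] by (subst Hx) auto
  qed
qed

text \<open>
  If the eigenvalues of the perturbations \<open>F + \<epsilon>\<close> all are at least \<open>1\<close>, the eigenvectors are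
  subharmonic up to \<open>\<epsilon>\<close>, and the bound survives the limit. Positivity does not, which is why the
  second alternative only gives a nonnegative vector.
\<close>
lemma super_or_sub_eigenvector:
  fixes F :: "real ^ 'n::finite \<Rightarrow> real ^ 'n"
  assumes cont: "continuous_on std_simplex F"
    and nonneg: "\<And>x j. x \<in> std_simplex \<Longrightarrow> 0 \<le> F x $ j"
  shows "(\<exists>x r. (\<forall>j. x $ j > 0) \<and> 0 < r \<and> r < 1 \<and> (\<forall>j. F x $ j \<le> r * x $ j))
    \<or> (\<exists>x \<in> std_simplex. \<forall>j. x $ j \<le> F x $ j)"
proof (subst disj_imp, rule impI)
  assume no_super: "\<not> (\<exists>x r. (\<forall>j. x $ j > 0) \<and> 0 < r \<and> r < 1 \<and> (\<forall>j. F x $ j \<le> r * x $ j))"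
  have "\<exists>x \<in> std_simplex. \<forall>j. x $ j \<le> F x $ j + 1 / real (Suc N)" for N
  proof -
    obtain x r where x: "x \<in> std_simplex" "r > 0" "\<And>j. x $ j > 0"
      and eq: "\<And>j. F x $ j + 1 / real (Suc N) = r * x $ j"
      using perturbed_positive_eigenvector[OF cont nonneg, of "1 / real (Suc N)"] by auto
    have "F x $ j \<le> r * x $ j" for j
      unfolding eq[symmetric] by simp
    then have "r \<ge> 1" using no_super x by (meson not_le)
    then have "x $ j \<le> r * x $ j" for j
      using mult_right_mono[of 1 r "x $ j"] x(3)[of j] by simp
    then show ?thesis using x(1) eq by metis
  qed
  then obtain X where X: "\<And>N. X N \<in> std_simplex"
    and sub: "\<And>N j. X N $ j \<le> F (X N) $ j + 1 / real (Suc N)"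
    by metis
  obtain x \<sigma> where x: "x \<in> std_simplex" and \<sigma>: "strict_mono \<sigma>" and lim: "(X \<circ> \<sigma>) \<longlonglongrightarrow> x"
    using compact_std_simplex X unfolding compact_def by metis
  have limF: "(\<lambda>N. F ((X \<circ> \<sigma>) N)) \<longlonglongrightarrow> F x"
    using cont x X lim by (intro continuous_on_tendsto_compose[OF cont lim x]) auto
  have "(\<lambda>N. 1 / real (Suc (\<sigma> N))) \<longlonglongrightarrow> 0"
    using LIMSEQ_subseq_LIMSEQ[OF lim_1_over_n[THEN LIMSEQ_Suc] \<sigma>] by (simp add: o_def)
  then have lim_rhs: "(\<lambda>N. F ((X \<circ> \<sigma>) N) $ j + 1 / real (Suc (\<sigma> N))) \<longlonglongrightarrow> F x $ j + 0" for j
    by (intro tendsto_intros limF)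
  have lim_lhs: "(\<lambda>N. (X \<circ> \<sigma>) N $ j) \<longlonglongrightarrow> x $ j" for j
    by (intro tendsto_intros lim)
  have "x $ j \<le> F x $ j + 0" for j
    by (rule LIMSEQ_le[OF lim_lhs lim_rhs]) (metis comp_apply sub)
  with x show "\<exists>x \<in> std_simplex. \<forall>j. x $ j \<le> F x $ j" by auto
qed

section \<open>The dynamic programming operator in exponential coordinates\<close>

lemma continuous_on_Max_image:
  fixes g :: "'a \<Rightarrow> 'b::topological_space \<Rightarrow> 'c::linorder_topology"
  assumes "finite A" "A \<noteq> {}" "\<And>a. a \<in> A \<Longrightarrow> continuous_on S (g a)"
  shows "continuous_on S (\<lambda>x. Max ((\<lambda>a. g a x) ` A))"
  using assms by (induction A rule: finite_ne_induct) (auto intro: continuous_on_max)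

lemma continuous_on_Min_image:
  fixes g :: "'a \<Rightarrow> 'b::topological_space \<Rightarrow> 'c::linorder_topology"
  assumes "finite A" "A \<noteq> {}" "\<And>a. a \<in> A \<Longrightarrow> continuous_on S (g a)"
  shows "continuous_on S (\<lambda>x. Min ((\<lambda>a. g a x) ` A))"
  using assms by (induction A rule: finite_ne_induct) (auto intro: continuous_on_min)

text \<open>
  The entry \<open>0\<close> at \<open>k = j\<close> stands for \<open>exp (-\<infinity>)\<close>, the value of the empty maximum that a matrix with a
  single column produces; it lies below all other entries as long as \<open>b\<close> and \<open>x\<close> are nonnegative.
\<close>
definition row_max :: "('m::finite \<Rightarrow> 'n::finite \<Rightarrow> real) \<Rightarrow> 'm \<Rightarrow> 'n \<Rightarrow> real ^ 'n \<Rightarrow> real" where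
  "row_max b i j x = Max ((\<lambda>k. if k = j then 0 else b i k * x $ k) ` UNIV)"

definition exp_op :: "('m::finite \<Rightarrow> 'n::finite \<Rightarrow> real) \<Rightarrow> real ^ 'n \<Rightarrow> real ^ 'n" where
  "exp_op b x = (\<chi> j. Min ((\<lambda>i. row_max b i j x / b i j) ` {i. 0 < b i j}))"

lemma row_max_nonneg: "0 \<le> row_max b i j x"
  unfolding row_max_def by (rule Max_ge) (auto intro!: image_eqI[of _ _ j])

lemma row_max_ge: "k \<noteq> j \<Longrightarrow> b i k * x $ k \<le> row_max b i j x"
  unfolding row_max_def by (rule Max_ge) (auto intro!: image_eqI[of _ _ k])

text \<open>
  The minimum over the rows is attained, so an upper bound on \<^const>\<open>exp_op\<close> singles out one row for
  each column, whereas a lower bound constrains all rows at once.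
\<close>
lemma matrix_alternative:
  fixes b :: "'m::finite \<Rightarrow> 'n::finite \<Rightarrow> real"
  assumes b: "\<And>i j. 0 \<le> b i j" and col: "\<And>j. \<exists>i. 0 < b i j"
  shows "(\<exists>x r. (\<forall>j. 0 < x $ j) \<and> 0 < r \<and> r < 1 \<and>
        (\<forall>j. \<exists>i. 0 < b i j \<and> (\<forall>k. k \<noteq> j \<longrightarrow> b i k * x $ k \<le> r * (b i j * x $ j))))
    \<or> (\<exists>x. (\<forall>j. 0 \<le> x $ j) \<and> (\<exists>j. x $ j \<noteq> 0) \<and> (\<forall>i j. b i j * x $ j \<le> row_max b i j x))"
proof -
  have ne: "{i. 0 < b i j} \<noteq> {}" for j using col by auto
  have "continuous_on S (\<lambda>x. if k = j then 0 else b i k * x $ k)" for S i j k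
    by (cases "k = j") (auto intro!: continuous_intros)
  then have "continuous_on std_simplex (exp_op b)"
    unfolding exp_op_def row_max_def
    by (intro continuous_on_vec_lambda continuous_on_Min_image continuous_on_divide
        continuous_on_Max_image ne continuous_on_const) auto
  moreover have "0 \<le> exp_op b x $ j" for x j
    using ne[of j] by (auto simp: exp_op_def row_max_nonneg intro!: divide_nonneg_nonneg b)
  ultimately consider
    (super) x r where "\<forall>j. 0 < x $ j" "0 < r" "r < 1" "\<forall>j. exp_op b x $ j \<le> r * x $ j"
    | (sub) x where "x \<in> std_simplex" "\<forall>j. x $ j \<le> exp_op b x $ j"
    using super_or_sub_eigenvector[of "exp_op b"] by blast
  then show ?thesis
  proof cases
    case super
    have "\<exists>i. 0 < b i j \<and> (\<forall>k. k \<noteq> j \<longrightarrow> b i k * x $ k \<le> r * (b i j * x $ j))" for j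
    proof -
      have "exp_op b x $ j \<in> (\<lambda>i. row_max b i j x / b i j) ` {i. 0 < b i j}"
        unfolding exp_op_def using ne[of j] by (auto intro!: Min_in)
      then obtain i where i: "0 < b i j" "exp_op b x $ j = row_max b i j x / b i j" by auto
      have "row_max b i j x \<le> r * (b i j * x $ j)"
        using super(4)[rule_format, of j] i by (simp add: field_simps)
      then show ?thesis using i(1) row_max_ge order_trans by blast
    qed
    then show ?thesis using super by blast
  next
    case sub
    have "b i j * x $ j \<le> row_max b i j x" for i j
    proof (cases "0 < b i j")
      case True
      have "x $ j \<le> exp_op b x $ j" using sub(2) by blast
      also have "\<dots> \<le> row_max b i j x / b i j"
        unfolding exp_op_def using True by (auto intro!: Min_le)
      finally show ?thesis using True by (simp add: field_simps)
    next
      case False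
      then have "b i j = 0" using b[of i j] by simp
      then show ?thesis by (simp add: row_max_nonneg)
    qed
    moreover have "\<exists>j. x $ j \<noteq> 0"
      using sub(1) by (auto simp: std_simplex_def intro: ccontr)
    ultimately show ?thesis using sub(1) by (auto simp: std_simplex_def)
  qed
qed

text \<open>
  The logarithm from \<open>[0, \<infinity>)\<close> onto \<open>\<real> \<union> {-\<infinity>}\<close>, extended to negative numbers so that it is monotone on
  the whole line.
\<close>
definition ext_ln :: "real \<Rightarrow> ereal" where
  "ext_ln t = (if t \<le> 0 then -\<infinity> else ereal (ln t))"

lemma ext_ln_mono: "s \<le> t \<Longrightarrow> ext_ln s \<le> ext_ln t"
  by (auto simp: ext_ln_def)

lemma ext_ln_mult: "0 \<le> s \<Longrightarrow> 0 \<le> t \<Longrightarrow> ext_ln (s * t) = ext_ln s + ext_ln t"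
  by (auto simp: ext_ln_def ln_mult mult_le_0_iff)

lemma ext_ln_pos: "0 < t \<Longrightarrow> ext_ln t = ereal (ln t)"
  by (simp add: ext_ln_def)

lemma ext_ln_not_PInf: "ext_ln t \<noteq> \<infinity>"
  by (simp add: ext_ln_def)

lemma ext_ln_eq_MInf: "ext_ln t = -\<infinity> \<longleftrightarrow> t \<le> 0"
  by (simp add: ext_ln_def)

lemma ext_ln_surj:
  assumes "a \<noteq> \<infinity>" obtains t where "0 \<le> t" "ext_ln t = a"
proof (cases a)
  case (real r)
  then show thesis using that[of "exp r"] by (simp add: ext_ln_def)
qed (use that[of 0] assms in \<open>simp_all add: ext_ln_def\<close>)

lemma dyn_op_le:
  assumes "B i j \<noteq> \<infinity>" "B i j \<noteq> -\<infinity>" "\<And>k. k \<noteq> j \<Longrightarrow> B i k + x k \<le> B i j + a"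
  shows "dyn_op B x j \<le> a"
proof -
  have "dyn_op B x j \<le> - B i j + (SUP k \<in> {k. k \<noteq> j}. B i k + x k)"
    unfolding dyn_op_def using assms(2) by (intro INF_lower) (auto simp: finite_entries_def)
  also have "\<dots> \<le> - B i j + (B i j + a)"
    using assms(3) by (intro add_left_mono SUP_least) auto
  also have "\<dots> = a"
    using assms(1,2) by (cases "B i j"; cases a) auto
  finally show ?thesis .
qed

text \<open>
  Where \<open>B i j = -\<infinity>\<close> the inequality on the right is trivial, which matches the restriction
  of the minimum in \<^const>\<open>dyn_op\<close> to finite entries.
\<close>
lemma le_dyn_op_iff:
  assumes B: "\<And>i j. B i j \<noteq> \<infinity>" and u: "\<And>j. u j \<noteq> \<infinity>"
  shows "u \<le> dyn_op B u \<longleftrightarrow> (\<forall>i j. B i j + u j \<le> (SUP k \<in> {k. k \<noteq> j}. B i k + u k))"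
proof -
  have shift: "u j \<le> - B i j + s \<longleftrightarrow> B i j + u j \<le> s" if "B i j \<noteq> -\<infinity>" for i j s
    using that B[of i j] by (cases "B i j"; cases "u j"; cases s) auto
  have "B i j + u j = -\<infinity>" if "B i j = -\<infinity>" for i j
    using that u[of j] by simp
  then show ?thesis
    unfolding le_fun_def dyn_op_def le_INF_iff finite_entries_def
    using shift by (auto, metis bot.extremum bot_ereal_def)
qed

text \<open>
  The logarithms of the two kinds of vectors in \<open>matrix_alternative\<close>. The super alternative stays in
  the reals because its vector is positive; in the other one, zeros turn into entries \<open>-\<infinity>\<close>.
\<close>
lemma supereigenvector_if_no_subharmonic:
  fixes B :: "'m::finite \<Rightarrow> 'n::finite \<Rightarrow> ereal"
  assumes entries: "\<And>i j. B i j \<noteq> \<infinity>" and columns: "\<And>j. \<exists>i. B i j \<noteq> -\<infinity>"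
    and no_sub: "\<not> (\<exists>u :: 'n \<Rightarrow> ereal. (\<forall>j. u j \<noteq> \<infinity>) \<and> (\<exists>j. u j \<noteq> -\<infinity>) \<and> u \<le> dyn_op B u)"
  shows "\<exists>(w :: 'n \<Rightarrow> real) c. c < 0 \<and> dyn_op B (\<lambda>j. ereal (w j)) \<le> (\<lambda>j. ereal (c + w j))"
proof -
  have "\<forall>i j. \<exists>t\<ge>0. ext_ln t = B i j" using ext_ln_surj entries by metis
  then obtain b where b: "\<And>i j. 0 \<le> b i j" and bB: "\<And>i j. ext_ln (b i j) = B i j" by metis
  have fin: "0 < b i j \<longleftrightarrow> B i j \<noteq> -\<infinity>" for i j
    using ext_ln_eq_MInf[of "b i j"] by (simp add: bB not_le flip: not_less)
  consider
    (super) x r where "\<And>j. 0 < x $ j" "0 < r" "r < 1"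
      "\<And>j. \<exists>i. 0 < b i j \<and> (\<forall>k. k \<noteq> j \<longrightarrow> b i k * x $ k \<le> r * (b i j * x $ j))"
    | (sub) x where "\<And>j. 0 \<le> x $ j" "\<exists>j. x $ j \<noteq> 0" "\<And>i j. b i j * x $ j \<le> row_max b i j x"
    using matrix_alternative[of b] b columns fin by metis
  then show ?thesis
  proof cases
    case super
    have "dyn_op B (\<lambda>j. ereal (ln (x $ j))) j \<le> ereal (ln r + ln (x $ j))" for j
    proof -
      obtain i where i: "0 < b i j"
        and le: "\<And>k. k \<noteq> j \<Longrightarrow> b i k * x $ k \<le> r * (b i j * x $ j)"
        using super(4) by blast
      show ?thesis
      proof (rule dyn_op_le[of B i])
        show "B i j \<noteq> -\<infinity>" "B i j \<noteq> \<infinity>" using i fin entries by auto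
        fix k assume "k \<noteq> j"
        have "ext_ln (b i k * x $ k) \<le> ext_ln (b i j * (r * x $ j))"
          using le[OF \<open>k \<noteq> j\<close>] by (intro ext_ln_mono) (simp add: mult.left_commute)
        then show "B i k + ereal (ln (x $ k)) \<le> B i j + ereal (ln r + ln (x $ j))"
          using super(1)[of j] super(1)[of k] super(2) b
          by (simp add: ext_ln_mult less_imp_le bB) (simp add: ext_ln_pos)
      qed
    qed
    moreover have "ln r < 0" using super by simp
    ultimately show ?thesis by (auto simp: le_fun_def intro!: exI[of _ "\<lambda>j. ln (x $ j)"] exI[of _ "ln r"])
  next
    case sub
    define u where "u j = ext_ln (x $ j)" for j
    have Bu: "B i k + u k = ext_ln (b i k * x $ k)" for i k
      by (simp add: ext_ln_mult b sub(1) bB u_def)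
    have "B i j + u j \<le> (SUP k \<in> {k. k \<noteq> j}. B i k + u k)" for i j
    proof -
      have "row_max b i j x \<in> (\<lambda>k. if k = j then 0 else b i k * x $ k) ` UNIV"
        unfolding row_max_def by (rule Max_in) auto
      then obtain k where k: "row_max b i j x = (if k = j then 0 else b i k * x $ k)" by blast
      have le: "B i j + u j \<le> ext_ln (row_max b i j x)"
        unfolding Bu by (intro ext_ln_mono sub(3))
      show ?thesis
      proof (cases "k = j")
        case True
        then have "B i j + u j \<le> -\<infinity>" using le k by (simp add: ext_ln_def)
        also have "-\<infinity> \<le> (SUP k \<in> {k. k \<noteq> j}. B i k + u k)" by simp
        finally show ?thesis .
      next
        case False
        then have "B i j + u j \<le> B i k + u k" using le k by (simp add: Bu)
        also have "\<dots> \<le> (SUP k \<in> {k. k \<noteq> j}. B i k + u k)"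
          using False by (intro SUP_upper) auto
        finally show ?thesis .
      qed
    qed
    then have "u \<le> dyn_op B u"
      using le_dyn_op_iff[of B u] entries ext_ln_not_PInf by (simp add: u_def)
    moreover have "\<exists>j. u j \<noteq> -\<infinity>"
      using sub(1,2) by (auto simp: u_def ext_ln_eq_MInf intro: order_antisym)
    ultimately show ?thesis using no_sub ext_ln_not_PInf u_def by metis
  qed
qed

section \<open>Tropical dependence and subharmonic vectors\<close>

text \<open>
  If a maximum above \<open>-\<infinity>\<close> is attained at \<open>j\<close> only, then the term at \<open>j\<close> strictly exceeds the maximum of
  the others; a maximum attained twice still has a maximiser left after the removal of any one index.
\<close>
lemma max_attained_twice_iff:
  fixes g :: "'n::finite \<Rightarrow> ereal"
  shows "(SUP j. g j) = -\<infinity> \<or> (\<exists>j k. j \<noteq> k \<and> g j = (SUP j. g j) \<and> g k = (SUP j. g j))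
    \<longleftrightarrow> (\<forall>j. g j \<le> (SUP k \<in> {k. k \<noteq> j}. g k))" (is "?twice \<longleftrightarrow> ?dom")
proof
  assume ?twice
  then show ?dom
  proof (elim disjE exE conjE)
    assume "(SUP j. g j) = -\<infinity>"
    then have "g j \<le> -\<infinity>" for j by (metis SUP_upper UNIV_I)
    then show ?dom by simp
  next
    fix j k assume jk: "j \<noteq> k" "g j = (SUP j. g j)" "g k = (SUP j. g j)"
    show ?dom
    proof
      fix l
      obtain l' where l': "l' \<noteq> l" "g l' = (SUP j. g j)" using jk by metis
      have "g l \<le> g l'" unfolding l'(2) by (rule SUP_upper) simp
      also have "\<dots> \<le> (SUP k \<in> {k. k \<noteq> l}. g k)" using l'(1) by (intro SUP_upper) auto
      finally show "g l \<le> (SUP k \<in> {k. k \<noteq> l}. g k)" .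
    qed
  qed
next
  assume dom: ?dom
  have "(SUP j. g j) \<in> range g" using finite_Sup_in[of "range g"] by (auto simp: sup_max max_def)
  then obtain j where j: "g j = (SUP j. g j)" by (metis imageE)
  show ?twice
  proof (cases "{k. k \<noteq> j} = {}")
    case True
    then have "g j \<le> -\<infinity>" using dom[rule_format, of j] by (simp add: bot_ereal_def)
    then show ?thesis using j by simp
  next
    case False
    then have "(SUP k \<in> {k. k \<noteq> j}. g k) \<in> g ` {k. k \<noteq> j}"
      using finite_Sup_in[of "g ` {k. k \<noteq> j}"] by (auto simp: sup_max max_def)
    then obtain k where k: "k \<noteq> j" "g k = (SUP k \<in> {k. k \<noteq> j}. g k)" by auto
    have "g k = (SUP j. g j)"
    proof (rule antisym)
      show "g k \<le> (SUP j. g j)" by (rule SUP_upper) simp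
      show "(SUP j. g j) \<le> g k" using dom j k(2) by metis
    qed
    then show ?thesis using j k(1) by blast
  qed
qed

lemma tropically_dependent_iff_subharmonic:
  assumes "\<And>i j. B i j \<noteq> \<infinity>"
  shows "tropically_dependent B \<longleftrightarrow>
    (\<exists>u. (\<forall>j. u j \<noteq> \<infinity>) \<and> (\<exists>j. u j \<noteq> -\<infinity>) \<and> u \<le> dyn_op B u)"
  unfolding tropically_dependent_def Let_def max_attained_twice_iff
  by (intro ex_cong1 conj_cong refl) (simp add: le_dyn_op_iff assms)

section \<open>Certificates for the sign of the upper value\<close>

context
  fixes B :: "'m::finite \<Rightarrow> 'n::finite \<Rightarrow> ereal"
  assumes entries: "\<And>i j. B i j \<noteq> \<infinity>" and columns: "\<And>j. \<exists>i. B i j \<noteq> -\<infinity>"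
begin

text \<open>
  By monotonicity and homogeneity the inequality iterates to \<open>f\<^sup>N(w) \<le> N c + w\<close>.
\<close>
lemma upper_value_le_if_supereigenvector:
  fixes w :: "'n \<Rightarrow> real"
  assumes w: "dyn_op B (\<lambda>j. ereal (w j)) \<le> (\<lambda>j. ereal (c + w j))"
  shows "upper_value (dyn_op B) \<le> ereal c"
proof -
  have iter: "(dyn_op B ^^ N) (\<lambda>k. ereal (w k)) \<le> (\<lambda>k. ereal (real N * c + w k))" for N
  proof (induction N)
    case (Suc N)
    have "(dyn_op B ^^ Suc N) (\<lambda>k. ereal (w k)) \<le> dyn_op B (\<lambda>k. ereal (real N * c) + ereal (w k))"
      using dyn_op_mono[OF Suc.IH] by simp
    also have "\<dots> \<le> (\<lambda>k. ereal (real N * c) + dyn_op B (\<lambda>k. ereal (w k)) k)"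
      using dyn_op_add_le[where B = B, OF entries columns] by (intro le_funI)
    also have "\<dots> \<le> (\<lambda>k. ereal (real N * c) + ereal (c + w k))"
      using w by (intro le_funI add_left_mono) (rule le_funD)
    also have "\<dots> = (\<lambda>k. ereal (real (Suc N) * c + w k))"
      by (simp add: algebra_simps)
    finally show ?case .
  qed simp
  define D where "D = (\<Sum>k\<in>UNIV. \<bar>w k\<bar>)"
  have D: "w k \<le> D" for k
    using member_le_sum[of k UNIV "\<lambda>k. \<bar>w k\<bar>"] by (auto simp: D_def)
  have bound: "(SUP j. (dyn_op B ^^ N) (\<lambda>k. ereal (w k)) j) / ereal (real N) \<le> ereal (c + D / real N)"
    if "N \<ge> 1" for N
  proof -
    have "(dyn_op B ^^ N) (\<lambda>k. ereal (w k)) j \<le> ereal (real N * c + D)" for j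
      using le_funD[OF iter[of N], of j] by (rule order_trans) (simp add: D)
    then have "(SUP j. (dyn_op B ^^ N) (\<lambda>k. ereal (w k)) j) \<le> ereal (real N * c + D)"
      by (rule SUP_least)
    then have "(SUP j. (dyn_op B ^^ N) (\<lambda>k. ereal (w k)) j) / ereal (real N)
        \<le> ereal (real N * c + D) / ereal (real N)"
      using that by (intro ereal_divide_right_mono) auto
    also have "\<dots> = ereal (c + D / real N)" using that by (simp add: field_simps)
    finally show ?thesis .
  qed
  have lim: "(\<lambda>N. ereal (c + D / real N)) \<longlonglongrightarrow> ereal (c + 0)"
    by (intro tendsto_ereal tendsto_add tendsto_const lim_const_over_n)
  show ?thesis
    using LIMSEQ_le[OF upper_value_dyn_op(1)[where B = B and x = w, OF entries columns] lim] bound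
    by auto
qed

text \<open>
  The vector \<open>u\<close> may have entries \<open>-\<infinity>\<close>, whereas the upper value is read off from finite starting
  vectors. Monotonicity allows any finite vector above \<open>u\<close> to be used instead.
\<close>
lemma upper_value_nonneg_if_subharmonic:
  assumes fin: "\<And>j. u j \<noteq> \<infinity>" and u: "u \<le> dyn_op B u" and j: "u j \<noteq> -\<infinity>"
  shows "0 \<le> upper_value (dyn_op B)"
proof -
  (* real_of_ereal sends -\<infinity> to 0, so x lies above u and agrees with it at finite entries. *)
  define x where "x k = real_of_ereal (u k)" for k
  have ux: "u \<le> (\<lambda>k. ereal (x k))"
  proof (rule le_funI)
    show "u k \<le> ereal (x k)" for k
      using fin[of k] unfolding x_def by (cases "u k") auto
  qed
  have "u \<le> (dyn_op B ^^ N) u" for N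
  proof (induction N)
    case (Suc N)
    have "u \<le> dyn_op B u" by (rule u)
    also have "\<dots> \<le> dyn_op B ((dyn_op B ^^ N) u)" by (rule dyn_op_mono[OF Suc.IH])
    finally show ?case by simp
  qed simp
  then have "u j \<le> (dyn_op B ^^ N) (\<lambda>k. ereal (x k)) j" for N
    using dyn_op_iter_mono[OF ux, of N B] by (meson le_funD order_trans)
  then have "u j \<le> (SUP j. (dyn_op B ^^ N) (\<lambda>k. ereal (x k)) j)" for N
    by (meson SUP_upper UNIV_I order_trans)
  moreover have uj: "u j = ereal (x j)" using fin[of j] j by (auto simp: x_def ereal_real)
  ultimately have bound: "ereal (x j / real N) \<le> (SUP j. (dyn_op B ^^ N) (\<lambda>k. ereal (x k)) j) / ereal (real N)"
    if "N \<ge> 1" for N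
    using ereal_divide_right_mono[of "ereal (x j)" _ "ereal (real N)"] that by auto
  have lim: "(\<lambda>N. ereal (x j / real N)) \<longlonglongrightarrow> ereal 0"
    by (intro tendsto_ereal lim_const_over_n)
  show ?thesis
    using LIMSEQ_le[OF lim upper_value_dyn_op(1)[where B = B and x = x, OF entries columns]] bound
    by (auto simp: zero_ereal_def)
qed

end

section \<open>The equivalence\<close>

theorem theorem4p9:
  fixes B :: "'m::finite \<Rightarrow> 'n::finite \<Rightarrow> ereal"
  assumes entries: "\<And>i j. B i j \<noteq> \<infinity>"
    and columns: "\<And>j. \<exists>i. B i j \<noteq> -\<infinity>"
  shows "(tropically_independent B \<longleftrightarrow> \<not> max_has_winning_state (dyn_op B))
    \<and> (\<not> max_has_winning_state (dyn_op B) \<longleftrightarrow>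
        (\<exists>(w :: 'n \<Rightarrow> real) (c :: real). c < 0 \<and>
          dyn_op B (\<lambda>j. ereal (w j)) \<le> (\<lambda>j. ereal (c + w j))))
    \<and> ((\<exists>(w :: 'n \<Rightarrow> real) (c :: real). c < 0 \<and>
          dyn_op B (\<lambda>j. ereal (w j)) \<le> (\<lambda>j. ereal (c + w j))) \<longleftrightarrow>
        \<not> (\<exists>u :: 'n \<Rightarrow> ereal. (\<forall>j. u j \<noteq> \<infinity>) \<and> (\<exists>j. u j \<noteq> -\<infinity>) \<and> u \<le> dyn_op B u))"
    (is "_ \<and> (_ \<longleftrightarrow> ?super) \<and> (_ \<longleftrightarrow> \<not> ?sub)")
proof -
  have "tropically_independent B \<longleftrightarrow> \<not> ?sub"
    unfolding tropically_independent_def using tropically_dependent_iff_subharmonic entries by blast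
  moreover have "\<not> max_has_winning_state (dyn_op B)" if ?super
  proof -
    obtain w :: "'n \<Rightarrow> real" and c
      where c: "c < 0" "dyn_op B (\<lambda>j. ereal (w j)) \<le> (\<lambda>j. ereal (c + w j))"
      using \<open>?super\<close> by blast
    have "upper_value (dyn_op B) \<le> ereal c"
      by (rule upper_value_le_if_supereigenvector[OF entries columns c(2)])
    also have "\<dots> < 0" using c(1) by simp
    finally show ?thesis by (simp add: max_has_winning_state_def)
  qed
  moreover have "max_has_winning_state (dyn_op B)" if ?sub
  proof -
    obtain u j where u: "\<And>j. u j \<noteq> \<infinity>" "u j \<noteq> -\<infinity>" "u \<le> dyn_op B u"
      using \<open>?sub\<close> by blast
    have "0 \<le> upper_value (dyn_op B)"
      by (rule upper_value_nonneg_if_subharmonic[OF entries columns u(1,3,2)])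
    then show ?thesis by (simp add: max_has_winning_state_def)
  qed
  moreover have ?super if "\<not> ?sub"
    by (rule supereigenvector_if_no_subharmonic[OF entries columns \<open>\<not> ?sub\<close>])
  ultimately show ?thesis by blast
qed

end
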